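(* Let $\varphi=(1+\sqrt5)/2$. For all integers $n\ge 1$: (a) $V_{\rm ue}(n)=2\left\lfloor\frac{\varphi+1}{2}n+\frac12\right\rfloor$; (b) $V_{\rm le}(n)=2\left\lfloor\frac{\varphi+1}{2}n\right\rfloor$; (c) $V_{\rm uo}(n)=2\left\lfloor\frac{\varphi+1}{2}n\right\rfloor+1$; (d) $V_{\rm lo}(n)=2\left\lfloor\frac{\varphi+1}{2}n+\frac12\right\rfloor-1$.
   Context: Let $L(n)=\lfloor n\varphi\rfloor$ and $U(n)=\lfloor n\varphi^2\rfloor$ for $n\ge 0$ (lower and upper Wythoff sequences). For $n\ge1$, let $I(n)$ be the set of integers $i\ge1$ such that $U(n-1)<L(i)<U(n+1)$ and $L(i-1)<U(n)<L(i+1)$. The swappage sequences are defined for $n\ge1$ as follows. Lower even (OEIS A141104): $V_{\rm le}(n)=U(n)$ if $U(n)$ is even; otherwise $V_{\rm le}(n)=L(i)$ with $i$ the least element of $I(n)$. Upper even (OEIS A141105): $V_{\rm ue}(n)=U(n)$ if $U(n)$ is even; otherwise $V_{\rm ue}(n)=L(i)$ with $i$ the greatest element of $I(n)$. Lower odd (OEIS A141106): $V_{\rm lo}(n)=U(n)$ if $U(n)$ is odd; otherwise $V_{\rm lo}(n)=L(i)$ with $i$ the least element of $I(n)$. Upper odd (OEIS A141107): $V_{\rm uo}(n)=U(n)$ if $U(n)$ is odd; otherwise $V_{\rm uo}(n)=L(i)$ with $i$ the greatest element of $I(n)$. *)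

theory Defs
  imports Complex_Main
begin

definition golden_ratio :: real ("\<phi>") where
  "\<phi> = (1 + sqrt 5) / 2"

definition lower_wythoff :: "nat \<Rightarrow> int" where
  "lower_wythoff n = \<lfloor>real n * \<phi>\<rfloor>"

definition upper_wythoff :: "nat \<Rightarrow> int" where
  "upper_wythoff n = \<lfloor>real n * \<phi>\<^sup>2\<rfloor>"

(* Only used for n \<ge> 1; then neither of the natural-number subtractions truncates. *)
definition neighbour_indices :: "nat \<Rightarrow> nat set" where
  "neighbour_indices n = {i. 1 \<le> i \<and>
     upper_wythoff (n - 1) < lower_wythoff i \<and> lower_wythoff i < upper_wythoff (n + 1) \<and>
     lower_wythoff (i - 1) < upper_wythoff n \<and> upper_wythoff n < lower_wythoff (i + 1)}"

definition lower_even_swappage :: "nat \<Rightarrow> int" where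
  "lower_even_swappage n =
     (if even (upper_wythoff n) then upper_wythoff n
      else lower_wythoff (LEAST i. i \<in> neighbour_indices n))"

definition upper_even_swappage :: "nat \<Rightarrow> int" where
  "upper_even_swappage n =
     (if even (upper_wythoff n) then upper_wythoff n
      else lower_wythoff (GREATEST i. i \<in> neighbour_indices n))"

definition lower_odd_swappage :: "nat \<Rightarrow> int" where
  "lower_odd_swappage n =
     (if odd (upper_wythoff n) then upper_wythoff n
      else lower_wythoff (LEAST i. i \<in> neighbour_indices n))"

definition upper_odd_swappage :: "nat \<Rightarrow> int" where
  "upper_odd_swappage n =
     (if odd (upper_wythoff n) then upper_wythoff n
      else lower_wythoff (GREATEST i. i \<in> neighbour_indices n))"

end

(* With k = L(n) one has L(k) = U(n) - 1 and L(k+1) = U(n) + 1: if f is the fractional part of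
   n\<phi>, which is positive since \<phi> is irrational, then k\<phi> = U(n) - f(\<phi> - 1).
   As L is monotone and consecutive values of U differ by at least 2, I(n) = {k, k+1}.  So each
   swappage term is the even or odd integer nearest to n\<phi>^2 from the appropriate side. *)
theory Submission
  imports Defs
begin

lemma golden_ratio_square: "\<phi>\<^sup>2 = \<phi> + 1"
  by (simp add: golden_ratio_def power2_eq_square field_simps)

lemma golden_ratio_bounds: "1 < \<phi>" "\<phi> < 2"
proof -
  have "1 < sqrt 5" "sqrt 5 < 3"
    by (simp_all add: real_less_lsqrt)
  then show "1 < \<phi>" "\<phi> < 2"
    by (simp_all add: golden_ratio_def)
qed

(* Infinite descent: if n \<phi> is an integer m, then (m - n) \<phi> = n and 0 < m - n < n. *)
lemma golden_ratio_multiple_not_Ints: "n \<ge> 1 \<Longrightarrow> real n * \<phi> \<notin> \<int>"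
proof (induction n rule: less_induct)
  case (less n)
  show ?case
  proof
    assume "real n * \<phi> \<in> \<int>"
    then obtain m :: int where m: "real n * \<phi> = of_int m"
      by (auto elim: Ints_cases)
    have "real n * 1 < real n * \<phi>" "real n * \<phi> < real n * 2"
      using less.prems golden_ratio_bounds by (auto intro!: mult_strict_left_mono)
    then have bounds: "int n < m" "m < 2 * int n"
      using m by linarith+
    define l where "l = nat (m - int n)"
    have l: "real l = real n * \<phi> - real n"
      using bounds m by (simp add: l_def)
    have "real l * \<phi> = real n * \<phi>\<^sup>2 - real n * \<phi>"
      by (simp add: l power2_eq_square algebra_simps)
    also have "\<dots> = real n"
      by (simp add: golden_ratio_square algebra_simps)
    finally have "real l * \<phi> \<in> \<int>"
      by simp
    moreover have "l < n" "l \<ge> 1"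
      using bounds by (auto simp: l_def)
    ultimately show False
      using less.IH by blast
  qed
qed

lemma lower_wythoff_mono: "i \<le> j \<Longrightarrow> lower_wythoff i \<le> lower_wythoff j"
  unfolding lower_wythoff_def
  using golden_ratio_bounds by (intro floor_mono mult_right_mono) auto

lemma upper_wythoff_conv_lower: "upper_wythoff n = lower_wythoff n + int n"
  by (simp add: upper_wythoff_def lower_wythoff_def golden_ratio_square distrib_left)

text \<open>The slope \<open>\<phi>\<^sup>2 = \<phi> + 1\<close> exceeds 2, and an integer shift
  passes through the floor. The gap 2 leaves room for U(n) - 1 and U(n) + 1 strictly between the
  neighbouring values of U.\<close>

lemma upper_wythoff_Suc: "upper_wythoff n + 2 \<le> upper_wythoff (Suc n)"
proof -
  have "real n * \<phi>\<^sup>2 + 2 \<le> real (Suc n) * \<phi>\<^sup>2"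
    using golden_ratio_bounds by (simp add: golden_ratio_square distrib_right)
  then show ?thesis
    unfolding upper_wythoff_def by linarith
qed

text \<open>Makes \<open>nat (lower_wythoff n)\<close> a faithful conversion and an admissible
  index, at least 1, in \<open>neighbour_indices\<close>.\<close>

lemma lower_wythoff_pos: "n \<ge> 1 \<Longrightarrow> lower_wythoff n \<ge> 1"
proof -
  have "lower_wythoff 1 \<ge> 1"
    using golden_ratio_bounds by (simp add: lower_wythoff_def)
  then show "lower_wythoff n \<ge> 1" if "n \<ge> 1"
    using lower_wythoff_mono[OF that] by linarith
qed

lemma lower_wythoff_around_upper:
  assumes "n \<ge> 1"
  shows "lower_wythoff (nat (lower_wythoff n)) = upper_wythoff n - 1"
    and "lower_wythoff (nat (lower_wythoff n) + 1) = upper_wythoff n + 1"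
proof -
  define k where "k = nat (lower_wythoff n)"
  define f where "f = frac (real n * \<phi>)"
  have f: "0 < f" "f < 1"
    using golden_ratio_multiple_not_Ints[OF assms] by (simp_all add: f_def frac_lt_1)
  have k: "real k = real n * \<phi> - f"
    using lower_wythoff_pos[OF assms] by (simp add: k_def f_def frac_def lower_wythoff_def)
  \<comment> \<open>As \<open>\<phi>\<^sup>2 = \<phi> + 1\<close>, the multiples of \<phi> and
    \<open>\<phi>\<^sup>2\<close> by n share the fractional part \<open>f\<close>.\<close>
  have U: "real_of_int (upper_wythoff n) = real n * \<phi> - f + real n"
    by (simp add: upper_wythoff_conv_lower lower_wythoff_def f_def frac_def)
  have "real k * \<phi> = real n * \<phi>\<^sup>2 - f * \<phi>"
    by (simp add: k power2_eq_square algebra_simps)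
  also have "\<dots> = upper_wythoff n - f * (\<phi> - 1)"
    by (simp add: golden_ratio_square U algebra_simps)
  finally have eq: "real k * \<phi> = upper_wythoff n - f * (\<phi> - 1)" .
  \<comment> \<open>Since \<phi> - 1 < 1, \<open>pos\<close> and \<open>less\<close> put
    \<open>real k * \<phi>\<close> strictly between U(n) - 1 and U(n).\<close>
  have pos: "0 < f * (\<phi> - 1)"
    using f golden_ratio_bounds by simp
  have less: "f * (\<phi> - 1) < \<phi> - 1"
    using f golden_ratio_bounds by simp
  show "lower_wythoff (nat (lower_wythoff n)) = upper_wythoff n - 1"
    unfolding k_def[symmetric] lower_wythoff_def[of k] eq
    using pos less golden_ratio_bounds by linarith
  \<comment> \<open>The offset \<phi> - f(\<phi> - 1) from U(n) lies strictly between 1 and \<phi> <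
    2.\<close>
  have "real (k + 1) * \<phi> = upper_wythoff n - f * (\<phi> - 1) + \<phi>"
    using eq by (simp add: distrib_right)
  then show "lower_wythoff (nat (lower_wythoff n) + 1) = upper_wythoff n + 1"
    unfolding k_def[symmetric] lower_wythoff_def[of "k + 1"]
    using pos less golden_ratio_bounds by linarith
qed

lemma neighbour_indices_eq:
  assumes "n \<ge> 1"
  shows "neighbour_indices n = {nat (lower_wythoff n), nat (lower_wythoff n) + 1}"
proof -
  define k where "k = nat (lower_wythoff n)"
  have k: "k \<ge> 1"
    using lower_wythoff_pos[OF assms] by (simp add: k_def)
  note L = lower_wythoff_around_upper[OF assms, folded k_def]
  have U: "upper_wythoff (n - 1) + 2 \<le> upper_wythoff n" "upper_wythoff n + 2 \<le> upper_wythoff (n + 1)"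
    using upper_wythoff_Suc[of "n - 1"] upper_wythoff_Suc[of n] assms by simp_all
  have "i \<in> {k, k + 1}" if "i \<in> neighbour_indices n" for i
  proof (rule ccontr)
    assume "i \<notin> {k, k + 1}"
    \<comment> \<open>By monotonicity, the first case gives L(i+1) \<le> U(n) - 1 and the second
      L(i-1) \<ge> U(n) + 1; each violates a condition on the neighbours of
      \<open>i\<close>.\<close>
    then have "i + 1 \<le> k \<or> k + 1 \<le> i - 1"
      by auto
    then show False
      using that L lower_wythoff_mono[of "i + 1" k] lower_wythoff_mono[of "k + 1" "i - 1"]
      by (auto simp: neighbour_indices_def)
  qed
  moreover have "k \<in> neighbour_indices n"
    using k L U lower_wythoff_mono[of "k - 1" k] by (simp add: neighbour_indices_def)
  moreover have "k + 1 \<in> neighbour_indices n"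
    using L U lower_wythoff_mono[of "k + 1" "k + 2"] by (simp add: neighbour_indices_def)
  ultimately show ?thesis
    unfolding k_def by blast
qed

lemma lower_wythoff_Least_neighbour:
  assumes "n \<ge> 1"
  shows "lower_wythoff (LEAST i. i \<in> neighbour_indices n) = upper_wythoff n - 1"
proof -
  have "(LEAST i. i \<in> neighbour_indices n) = nat (lower_wythoff n)"
    by (rule Least_equality) (auto simp: neighbour_indices_eq[OF assms])
  then show ?thesis
    by (simp add: lower_wythoff_around_upper[OF assms])
qed

lemma lower_wythoff_Greatest_neighbour:
  assumes "n \<ge> 1"
  shows "lower_wythoff (GREATEST i. i \<in> neighbour_indices n) = upper_wythoff n + 1"
proof -
  have "(GREATEST i. i \<in> neighbour_indices n) = nat (lower_wythoff n) + 1"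
    by (rule Greatest_equality) (auto simp: neighbour_indices_eq[OF assms])
  then show ?thesis
    using lower_wythoff_around_upper(2)[OF assms] by simp
qed

text \<open>Halving, flooring and doubling rounds the floor of \<open>x\<close> down to an even
  integer; this brings parity into the closed forms.\<close>

lemma twice_floor_half:
  fixes x :: real
  shows "2 * \<lfloor>x / 2\<rfloor> = (if even \<lfloor>x\<rfloor> then \<lfloor>x\<rfloor> else \<lfloor>x\<rfloor> - 1)"
proof -
  have "\<lfloor>x / 2\<rfloor> = \<lfloor>x\<rfloor> div 2"
    using floor_divide_real_eq_div[of 2 x] by simp
  then show ?thesis
    by (auto elim: oddE)
qed

theorem theorem21:
  fixes n :: nat
  assumes "n \<ge> 1"
  shows "upper_even_swappage n = 2 * \<lfloor>(\<phi> + 1) / 2 * real n + 1 / 2\<rfloor> \<and>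
         lower_even_swappage n = 2 * \<lfloor>(\<phi> + 1) / 2 * real n\<rfloor> \<and>
         upper_odd_swappage n = 2 * \<lfloor>(\<phi> + 1) / 2 * real n\<rfloor> + 1 \<and>
         lower_odd_swappage n = 2 * \<lfloor>(\<phi> + 1) / 2 * real n + 1 / 2\<rfloor> - 1"
proof -
  let ?x = "real n * \<phi>\<^sup>2"
  have x: "(\<phi> + 1) / 2 * real n = ?x / 2" "(\<phi> + 1) / 2 * real n + 1 / 2 = (?x + 1) / 2"
    by (simp_all add: golden_ratio_square field_simps)
  have down: "2 * \<lfloor>(\<phi> + 1) / 2 * real n\<rfloor> =
      (if even (upper_wythoff n) then upper_wythoff n else upper_wythoff n - 1)"
    unfolding x(1) twice_floor_half upper_wythoff_def ..
  \<comment> \<open>The summand 1/2 replaces \<open>?x\<close> by \<open>?x + 1\<close>, whose floor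
    U(n) + 1 has the opposite parity: rounding it down to even rounds U(n) up to even.\<close>
  have up: "2 * \<lfloor>(\<phi> + 1) / 2 * real n + 1 / 2\<rfloor> =
      (if even (upper_wythoff n) then upper_wythoff n else upper_wythoff n + 1)"
    unfolding x(2) twice_floor_half by (simp add: upper_wythoff_def)
  \<comment> \<open>For the odd sequences, \<open>down\<close> plus 1 rounds U(n) up to odd and
    \<open>up\<close> minus 1 rounds it down to odd.\<close>
  show ?thesis
    unfolding up down upper_even_swappage_def lower_even_swappage_def
      upper_odd_swappage_def lower_odd_swappage_def
      lower_wythoff_Least_neighbour[OF assms] lower_wythoff_Greatest_neighbour[OF assms]
    by simp
qed

end
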